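(* The set of nilpotent elements in $M_2$ is a right circular cone.
   Context: $M_2$ is the semigroup of linear endomorphisms of a real plane, represented as the multiplicative semigroup of real $2\times 2$ matrices relative to a fixed ordered orthonormal basis, and identified with $\mathbb{R}^4$ by listing entries row-wise, with the usual inner product $\langle x,y\rangle = \operatorname{tr}(x^* y)$, where $x^*$ is the transpose of $x$. A subset of $\mathbb{R}^4$ is called a right circular cone if it is contained in some three-dimensional affine subspace $H$ of $\mathbb{R}^4$ and there are rectangular Cartesian (orthonormal) coordinates $(X,Y,Z)$ on $H$, with some origin in $H$, and a real $k>0$ such that the subset is the full solution set in $H$ of $X^2+Y^2=k^2Z^2$. *)

theory Defs
  imports "HOL-Analysis.Analysis"
begin

type_synonym M2 = "real ^ 2 ^ 2"

text \<open>
  The operator \<open>*\<close>, hence also \<open>^\<close>, acts entrywise on vectors and matrices in HOL-Analysis;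
  matrix powers therefore have to be built from \<open>**\<close>.
\<close>

definition mat_power :: "M2 \<Rightarrow> nat \<Rightarrow> M2" where
  "mat_power A n = (((**) A) ^^ n) (mat 1)"

definition nilpotent :: "M2 \<Rightarrow> bool" where
  "nilpotent A \<longleftrightarrow> (\<exists>n\<ge>1. mat_power A n = 0)"

definition entries :: "M2 \<Rightarrow> real ^ 4" where
  "entries A = vector [A $ 1 $ 1, A $ 1 $ 2, A $ 2 $ 1, A $ 2 $ 2]"

lemma vector_4:
  fixes a b c d :: "'a :: zero"
  shows "(vector [a, b, c, d] :: 'a ^ 4) $ 1 = a"
    and "(vector [a, b, c, d] :: 'a ^ 4) $ 2 = b"
    and "(vector [a, b, c, d] :: 'a ^ 4) $ 3 = c"
    and "(vector [a, b, c, d] :: 'a ^ 4) $ 4 = d"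
  unfolding vector_def by simp_all

lemma inner_entries: "entries A \<bullet> entries B = trace (transpose A ** B)"
  by (simp add: entries_def trace_def transpose_def matrix_matrix_mult_def inner_vec_def
      sum_2 sum_4 vector_4)

text \<open>
  The triple \<open>u\<close>, \<open>v\<close>, \<open>w\<close> is an orthonormal basis of the direction space of \<open>H\<close>, and the
  coordinates of \<open>x \<in> H\<close> with respect to the origin \<open>p\<close> are its inner products with \<open>x - p\<close>.
\<close>

definition right_circular_cone :: "(real ^ 4) set \<Rightarrow> bool" where
  "right_circular_cone S \<longleftrightarrow>
    (\<exists>H. affine H \<and> aff_dim H = 3 \<and>
      (\<exists>p u v w k.
        p \<in> H \<and> p + u \<in> H \<and> p + v \<in> H \<and> p + w \<in> H \<and>
        norm u = 1 \<and> norm v = 1 \<and> norm w = 1 \<and>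
        orthogonal u v \<and> orthogonal u w \<and> orthogonal v w \<and>
        k > 0 \<and>
        S = {x \<in> H. ((x - p) \<bullet> u)\<^sup>2 + ((x - p) \<bullet> v)\<^sup>2 = k\<^sup>2 * ((x - p) \<bullet> w)\<^sup>2}))"

end

(*
  By Cayley-Hamilton, A ** A = tr A * A - det A * I. A nilpotent A has det A = 0, so all its powers
  are (tr A)^n * A, which forces tr A = 0; conversely tr A = det A = 0 gives A ** A = 0. So the
  nilpotent matrices are those with rows (a, b), (c, -a) and a^2 + b c = 0. In the orthonormal
  coordinates X = sqrt 2 * a, Y = (b + c) / sqrt 2, Z = (b - c) / sqrt 2 on the hyperplane of
  trace-zero matrices, 2 (a^2 + b c) = X^2 + Y^2 - Z^2.
*)
theory Submission
  imports Defs
begin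

lemma cayley_hamilton_2:
  fixes A :: "real ^ 2 ^ 2"
  shows "A ** A = trace A *\<^sub>R A - det A *\<^sub>R mat 1"
  by (simp add: vec_eq_iff forall_2 matrix_matrix_mult_def sum_2 trace_def det_2 mat_def
      algebra_simps)

lemma mat_power_0 [simp]: "mat_power A 0 = mat 1"
  by (simp add: mat_power_def)

lemma mat_power_Suc [simp]: "mat_power A (Suc n) = A ** mat_power A n"
  by (simp add: mat_power_def)

lemma det_mat_power: "det (mat_power A n) = det A ^ n"
  by (induction n) (simp_all add: det_mul)

text \<open>Without the determinant term, Cayley-Hamilton says that multiplying \<open>A\<close> by
  \<open>A\<close> only scales it by \<open>trace A\<close>; the first factor \<open>A\<close> is
  free, hence the exponent \<open>n\<close>.\<close>

lemma mat_power_Suc_of_det_0: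
  assumes "det A = 0"
  shows "mat_power A (Suc n) = trace A ^ n *\<^sub>R A"
proof (induction n)
  case (Suc n)
  have "mat_power A (Suc (Suc n)) = trace A ^ n *\<^sub>R (A ** A)"
    using Suc by (simp add: matrix_scalar_ac scalar_matrix_assoc)
  then show ?case
    using assms by (simp add: cayley_hamilton_2 mult.commute)
qed simp

lemma nilpotent_iff_trace_det: "nilpotent A \<longleftrightarrow> trace A = 0 \<and> det A = 0"
proof
  assume "nilpotent A"
  then obtain n where "mat_power A (Suc n) = 0"
    unfolding nilpotent_def by (metis One_nat_def Suc_le_D)
  moreover from this have "det A = 0"
    using det_mat_power[of A "Suc n"] by (auto simp: det_2 simp del: mat_power_Suc)
  ultimately have "trace A ^ n *\<^sub>R A = 0"
    by (metis mat_power_Suc_of_det_0)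
  \<comment> \<open>Either \<open>trace A\<close> vanishes or \<open>A = 0\<close>, whose trace is
    zero as well; \<open>n = 0\<close> forces the latter.\<close>
  with \<open>det A = 0\<close> show "trace A = 0 \<and> det A = 0"
    by (auto simp: trace_def)
next
  assume "trace A = 0 \<and> det A = 0"
  then have "mat_power A (Suc 1) = 0"
    using mat_power_Suc_of_det_0[of A 1] by simp
  then show "nilpotent A"
    unfolding nilpotent_def by (intro exI[of _ "Suc 1"]) simp
qed

lemma entries_image_nilpotent:
  "entries ` {A. nilpotent A} = {x. x $ 1 + x $ 4 = 0 \<and> x $ 1 * x $ 4 - x $ 2 * x $ 3 = 0}"
proof -
  have "x \<in> entries ` {A. nilpotent A}"
    if "x $ 1 + x $ 4 = 0" "x $ 1 * x $ 4 - x $ 2 * x $ 3 = 0" for x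
  proof
    let ?A = "vector [vector [x $ 1, x $ 2], vector [x $ 3, x $ 4]] :: M2"
    show "x = entries ?A"
      by (simp add: entries_def vec_eq_iff forall_4 vector_4)
    show "?A \<in> {A. nilpotent A}"
      using that by (simp add: nilpotent_iff_trace_det trace_def det_2 sum_2)
  qed
  then show ?thesis
    by (auto simp: nilpotent_iff_trace_det entries_def vector_4 trace_def det_2 sum_2)
qed

theorem mainTheorem3:
  shows "right_circular_cone (entries ` {A. nilpotent A})"
proof -
  \<comment> \<open>The normal vector is the identity matrix, whose inner product with
    \<open>A\<close> is \<open>trace A\<close>.\<close>
  define H :: "(real ^ 4) set" where "H = {x. vector [1, 0, 0, 1] \<bullet> x = 0}"
  define s :: real where "s = 1 / sqrt 2"
  \<comment> \<open>The axis \<open>w\<close> spans the skew-symmetric matrices; \<open>u\<close>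
    and \<open>v\<close> span the symmetric ones of trace zero.\<close>
  define u v w :: "real ^ 4"
    where "u = vector [s, 0, 0, -s]" and "v = vector [0, s, s, 0]" and "w = vector [0, s, -s, 0]"
  note coords = inner_vec_def sum_4 vector_4
  have s: "s * s = 1 / 2"
    by (simp add: s_def)
  have "affine H"
    unfolding H_def by (rule affine_hyperplane)
  moreover have "aff_dim H = 3"
  proof -
    have "(vector [1, 0, 0, 1] :: real ^ 4) \<noteq> 0"
      by (simp add: vec_eq_iff forall_4 vector_4)
    then show ?thesis
      unfolding H_def by (subst aff_dim_hyperplane) auto
  qed
  moreover have "0 \<in> H" "0 + u \<in> H" "0 + v \<in> H" "0 + w \<in> H"
    by (simp_all add: H_def u_def v_def w_def coords)
  moreover have "norm u = 1" "norm v = 1" "norm w = 1"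
    by (simp_all add: norm_eq_1 u_def v_def w_def coords s)
  moreover have "orthogonal u v" "orthogonal u w" "orthogonal v w"
    by (simp_all add: orthogonal_def u_def v_def w_def coords)
  moreover have "entries ` {A. nilpotent A} =
    {x \<in> H. ((x - 0) \<bullet> u)\<^sup>2 + ((x - 0) \<bullet> v)\<^sup>2 = 1\<^sup>2 * ((x - 0) \<bullet> w)\<^sup>2}"
  proof -
    \<comment> \<open>On \<open>H\<close> the form of the cone with \<open>k = 1\<close> is a
      nonzero multiple of the determinant, so both have the same zeros.\<close>
    have "(x \<bullet> u)\<^sup>2 + (x \<bullet> v)\<^sup>2 - (x \<bullet> w)\<^sup>2 = - 2 * (x $ 1 * x $ 4 - x $ 2 * x $ 3)"
      if "x $ 1 + x $ 4 = 0" for x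
    proof -
      have "x $ 4 = - x $ 1"
        using that by simp
      \<comment> \<open>Here \<open>s\<close> occurs only through \<open>s * s\<close>, so no square
        root has to be evaluated.\<close>
      then have "(x \<bullet> u)\<^sup>2 + (x \<bullet> v)\<^sup>2 - (x \<bullet> w)\<^sup>2
          = (s * s) * (4 * (x $ 1 * x $ 1) + 4 * (x $ 2 * x $ 3))"
        by (simp add: u_def v_def w_def coords power2_eq_square algebra_simps)
      then show ?thesis
        using \<open>x $ 4 = - x $ 1\<close> by (simp add: s)
    qed
    moreover have "x \<in> H \<longleftrightarrow> x $ 1 + x $ 4 = 0" for x
      by (simp add: H_def coords)
    ultimately show ?thesis
      unfolding entries_image_nilpotent by fastforce
  qed
  ultimately show ?thesis
    unfolding right_circular_cone_def
    by (intro exI[of _ H] exI[of _ 0] exI[of _ u] exI[of _ v] exI[of _ w] exI[of _ 1] conjI) simp_all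
qed

end
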